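(* Let $P$ be a finite set of players partitioned into $m$ disjoint subsets $P=P_1\cup\dots\cup P_m$ with $n_i=|P_i|$, and let $k_1<\dots<k_{m-1}\le k_m$ be positive integers. Let $H$ be the conjunctive hierarchical game on $P$, i.e. $X\subseteq P$ is winning iff $|X\cap(P_1\cup\dots\cup P_i)|\ge k_i$ for all $i\in\{1,\dots,m\}$. Then the equivalence relation $\sim_H$ has exactly $m$ equivalence classes (so that the canonical representation of $H$ is defined on the multiset $\{1^{n_1},\dots,m^{n_m}\}$) if and only if (a) $k_1\le n_1$, and (b) $k_i<k_{i-1}+n_i$ for every $1<i\le m$. When (a) and (b) hold, the sequence $(k_1,\dots,k_m)$ is uniquely determined: if $k'_1<\dots<k'_{m-1}\le k'_m$ are positive integers such that the conjunctive hierarchical game on $P$ with the same partition and thresholds $k'_i$ equals $H$, then $k'_i=k_i$ for all $i$. All players of $P_m$ are dummies if and only if $k_{m-1}=k_m$.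
   Context: A simple game on a finite set $P$ is a pair $(P,W)$ where $W$ is a nonempty family of subsets of $P$ (winning coalitions) closed under supersets. A player is a dummy if it belongs to no minimal winning coalition. The relation $\sim_G$ on $P$ is defined by $i\sim_G j$ iff for every $X\subseteq P$ containing neither $i$ nor $j$, $X\cup\{i\}\in W\iff X\cup\{j\}\in W$; it is an equivalence relation. If its classes have sizes $n_1,\dots,n_m$, the canonical representation of $G$ is the game on the multiset $\{1^{n_1},\dots,m^{n_m}\}$ in which $\{1^{\ell_1},\dots,m^{\ell_m}\}$ is winning iff a coalition with $\ell_i$ players from the $i$-th class for each $i$ is winning in $G$. *)

theory Defs
  imports "HOL-Library.Disjoint_Sets" "HOL-Library.Multiset"
begin

definition simple_game :: "'a set \<Rightarrow> 'a set set \<Rightarrow> bool" where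
  "simple_game P W \<longleftrightarrow>
     finite P \<and> W \<subseteq> Pow P \<and> W \<noteq> {} \<and>
     (\<forall>X Y. X \<in> W \<and> X \<subseteq> Y \<and> Y \<subseteq> P \<longrightarrow> Y \<in> W)"

definition minimal_winning :: "'a set set \<Rightarrow> 'a set \<Rightarrow> bool" where
  "minimal_winning W X \<longleftrightarrow> X \<in> W \<and> (\<forall>Y. Y \<subset> X \<longrightarrow> Y \<notin> W)"

definition dummy :: "'a set \<Rightarrow> 'a set set \<Rightarrow> 'a \<Rightarrow> bool" where
  "dummy P W i \<longleftrightarrow> i \<in> P \<and> \<not> (\<exists>X. minimal_winning W X \<and> i \<in> X)"

definition player_equiv :: "'a set \<Rightarrow> 'a set set \<Rightarrow> ('a \<times> 'a) set" where
  "player_equiv P W =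
     {(i, j). i \<in> P \<and> j \<in> P \<and>
        (\<forall>X. X \<subseteq> P \<and> i \<notin> X \<and> j \<notin> X \<longrightarrow> (insert i X \<in> W \<longleftrightarrow> insert j X \<in> W))}"

text \<open>The classes of players come without a preferred numbering, so the canonical
  representation is a relation: it holds of the multiset \<open>M\<close> and the family \<open>V\<close> of winning
  submultisets of \<open>M\<close> obtained from some numbering \<open>C\<close> of the classes.\<close>

definition canonical_representation ::
    "'a set \<Rightarrow> 'a set set \<Rightarrow> nat multiset \<Rightarrow> nat multiset set \<Rightarrow> bool" where
  "canonical_representation P W M V \<longleftrightarrow>
     (\<exists>m C. bij_betw C {1..m} (P // player_equiv P W) \<and>
        M = (\<Sum>i\<in>{1..m}. replicate_mset (card (C i)) i) \<and>
        V = {L. L \<subseteq># M \<and> (\<exists>X\<in>W. \<forall>i\<in>{1..m}. card (X \<inter> C i) = count L i)})"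

text \<open>The sequence \<open>k\<^sub>1 < \<dots> < k\<^sub>m\<^sub>-\<^sub>1 \<le> k\<^sub>m\<close> of positive integers; the value \<open>k 0\<close> is irrelevant.\<close>

definition hierarchy_thresholds :: "nat \<Rightarrow> (nat \<Rightarrow> nat) \<Rightarrow> bool" where
  "hierarchy_thresholds m k \<longleftrightarrow>
     (\<forall>i\<in>{1..m}. 0 < k i) \<and> strict_mono_on {1..m - 1} k \<and> (2 \<le> m \<longrightarrow> k (m - 1) \<le> k m)"

definition conjunctive_hierarchical ::
    "'a set \<Rightarrow> nat \<Rightarrow> (nat \<Rightarrow> 'a set) \<Rightarrow> (nat \<Rightarrow> nat) \<Rightarrow> 'a set set" where
  "conjunctive_hierarchical P m Q k =
     {X. X \<subseteq> P \<and> (\<forall>i\<in>{1..m}. k i \<le> card (X \<inter> (\<Union>j\<in>{1..i}. Q j)))}"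

end

theory Submission
  imports Defs
begin

text \<open>Two players of the same block are always equivalent, so the number of classes is \<open>m\<close> iff
  players of different blocks are never equivalent. If \<open>k\<^sub>i \<ge> k\<^sub>i\<^sub>-\<^sub>1 + n\<^sub>i\<close>, the condition with index
  \<open>i - 1\<close> follows from the one with index \<open>i\<close>, and the blocks \<open>i - 1\<close> and \<open>i\<close> merge. Under (a)
  and (b), a coalition with \<open>k\<^sub>l - k\<^sub>l\<^sub>-\<^sub>1\<close> players of block \<open>l\<close> for \<open>l \<le> i\<close> and all but one player
  of every later block is winning and meets the \<open>i\<close>-th condition with equality. Moving one of its
  players from block \<open>i\<close> to a later block makes it losing, which separates the blocks; and its
  existence determines \<open>k\<^sub>i\<close>.\<close>

section \<open>Equivalence of players for an arbitrary family of coalitions\<close>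

lemma player_equiv_sym: "(x, y) \<in> player_equiv P W \<Longrightarrow> (y, x) \<in> player_equiv P W"
  by (auto simp: player_equiv_def)

text \<open>The only real case is three distinct players with \<open>y\<close> in \<open>X\<close>.
  Writing \<open>X = insert y Y\<close>, the coalition \<open>Y\<close> together with
  \<open>x\<close> and \<open>z\<close> is the link: exchanging \<open>y\<close> and
  \<open>z\<close> beside \<open>x\<close> reaches it from \<open>insert x X\<close>, and exchanging
  \<open>x\<close> and \<open>y\<close> beside \<open>z\<close> leads on to
  \<open>insert z X\<close>.\<close>

lemma player_equiv_trans:
  assumes "(x, y) \<in> player_equiv P W" and "(y, z) \<in> player_equiv P W"
  shows "(x, z) \<in> player_equiv P W"
proof -
  have P: "x \<in> P" "y \<in> P" "z \<in> P"
    and xy: "\<And>X. X \<subseteq> P \<Longrightarrow> x \<notin> X \<Longrightarrow> y \<notin> X \<Longrightarrow> insert x X \<in> W \<longleftrightarrow> insert y X \<in> W"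
    and yz: "\<And>X. X \<subseteq> P \<Longrightarrow> y \<notin> X \<Longrightarrow> z \<notin> X \<Longrightarrow> insert y X \<in> W \<longleftrightarrow> insert z X \<in> W"
    using assms by (auto simp: player_equiv_def)
  have "insert x X \<in> W \<longleftrightarrow> insert z X \<in> W" if X: "X \<subseteq> P" "x \<notin> X" "z \<notin> X" for X
  proof (cases "x = y \<or> y = z \<or> x = z \<or> y \<notin> X")
    case True
    then show ?thesis using xy[of X] yz[of X] X by auto
  next
    case False
    define Y where "Y = X - {y}"
    have Y: "X = insert y Y" "y \<notin> Y" "Y \<subseteq> P" "x \<notin> Y" "z \<notin> Y"
      using False X by (auto simp: Y_def)
    have "insert y (insert x Y) \<in> W \<longleftrightarrow> insert z (insert x Y) \<in> W"
      using yz[of "insert x Y"] Y P False by auto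
    moreover have "insert x (insert z Y) \<in> W \<longleftrightarrow> insert y (insert z Y) \<in> W"
      using xy[of "insert z Y"] Y P False by auto
    ultimately show ?thesis
      by (simp add: Y(1) insert_commute)
  qed
  then show ?thesis
    using P by (simp add: player_equiv_def)
qed

section \<open>Monotonicity of the thresholds\<close>

lemma hierarchy_thresholds_le:
  assumes k: "hierarchy_thresholds m k" and "1 \<le> i" "i \<le> j" "j \<le> m"
  shows "k i \<le> k j"
proof -
  have below: "k a \<le> k b" if "1 \<le> a" "a \<le> b" "b \<le> m - 1" for a b
    using k that strict_mono_onD[of "{1..m - 1}" k a b]
    by (cases "a = b") (auto simp: hierarchy_thresholds_def)
  show ?thesis
  proof (cases "j \<le> m - 1 \<or> i = j")
    case True
    then show ?thesis using below assms by auto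
  next
    \<comment> \<open>The strict chain stops at \<open>m - 1\<close>, so a comparison ending in
      \<open>m\<close> goes through \<open>k (m - 1)\<close> and the weak last inequality.\<close>
    case False
    then have "j = m" "i \<le> m - 1" "2 \<le> m" using assms by auto
    then show ?thesis
      using below[of i "m - 1"] assms by (auto simp: hierarchy_thresholds_def)
  qed
qed

lemma hierarchy_thresholds_less:
  assumes "hierarchy_thresholds m k" and "1 \<le> i" "i < j" "j < m"
  shows "k i < k j"
  using assms strict_mono_onD[of "{1..m - 1}" k i j] by (auto simp: hierarchy_thresholds_def)

section \<open>Counting players in initial unions of blocks\<close>

text \<open>Only the partition is fixed, not the thresholds, because uniqueness compares two
  threshold sequences over the same blocks.\<close>

locale player_partition =
  fixes P :: "'a set" and m :: nat and Q :: "nat \<Rightarrow> 'a set"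
  assumes finite_players: "finite P"
    and union_blocks: "P = (\<Union>i\<in>{1..m}. Q i)"
    and disjoint_blocks: "disjoint_family_on Q {1..m}"
    and blocks_nonempty: "i \<in> {1..m} \<Longrightarrow> Q i \<noteq> {}"
begin

abbreviation initial :: "nat \<Rightarrow> 'a set" where
  "initial i \<equiv> \<Union>j\<in>{1..i}. Q j"

abbreviation winning :: "(nat \<Rightarrow> nat) \<Rightarrow> 'a set set" where
  "winning k \<equiv> conjunctive_hierarchical P m Q k"

text \<open>Conditions (a) and (b) of the theorem, as a predicate of \<open>k\<close> so that they
  can also be asserted of a competing sequence.\<close>

definition tight :: "(nat \<Rightarrow> nat) \<Rightarrow> bool" where
  "tight k \<longleftrightarrow>
     k 1 \<le> card (Q 1) \<and> (\<forall>i. 1 < i \<and> i \<le> m \<longrightarrow> k i < k (i - 1) + card (Q i))"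

lemma block_subset: "i \<in> {1..m} \<Longrightarrow> Q i \<subseteq> P"
  using union_blocks by auto

lemma finite_block: "i \<in> {1..m} \<Longrightarrow> finite (Q i)"
  using block_subset finite_players finite_subset by blast

lemma block_unique:
  assumes "x \<in> Q i" "x \<in> Q j" "i \<in> {1..m}" "j \<in> {1..m}"
  shows "i = j"
  using assms disjoint_family_onD[OF disjoint_blocks, of i j] by blast

lemma inj_on_blocks: "inj_on Q {1..m}"
  using block_unique blocks_nonempty by (metis all_not_in_conv inj_onI)

lemma initial_eq: "initial m = P"
  using union_blocks by simp

lemma mem_initial_iff:
  assumes "x \<in> Q j" "j \<in> {1..m}" "i \<le> m"
  shows "x \<in> initial i \<longleftrightarrow> j \<le> i"
proof
  assume "x \<in> initial i"
  then obtain l where "l \<in> {1..i}" "x \<in> Q l" by auto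
  then show "j \<le> i" using block_unique[of x j l] assms by auto
qed (use assms in auto)

lemma card_Int_initial:
  assumes "i \<le> m"
  shows "card (X \<inter> initial i) = (\<Sum>j\<in>{1..i}. card (X \<inter> Q j))"
proof -
  have "X \<inter> initial i = (\<Union>j\<in>{1..i}. X \<inter> Q j)" by auto
  moreover have "card (\<Union>j\<in>{1..i}. X \<inter> Q j) = (\<Sum>j\<in>{1..i}. card (X \<inter> Q j))"
  proof (rule card_UN_disjoint)
    show "\<forall>j\<in>{1..i}. finite (X \<inter> Q j)"
      using finite_block assms by auto
    show "\<forall>a\<in>{1..i}. \<forall>b\<in>{1..i}. a \<noteq> b \<longrightarrow> X \<inter> Q a \<inter> (X \<inter> Q b) = {}"
      using block_unique assms by fastforce
  qed simp
  ultimately show ?thesis by simp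
qed

lemma card_insert_Int_initial:
  assumes "x \<in> Q j" "j \<in> {1..m}" "i \<le> m" "x \<notin> X" "X \<subseteq> P"
  shows "card (insert x X \<inter> initial i) = card (X \<inter> initial i) + of_bool (j \<le> i)"
proof -
  have "finite (X \<inter> initial i)"
    using assms finite_players finite_subset by blast
  moreover have "x \<in> initial i \<longleftrightarrow> j \<le> i"
    using mem_initial_iff assms by blast
  ultimately show ?thesis
    using assms(4) by (simp add: Int_insert_left)
qed

lemma card_Diff_Int_initial:
  assumes "x \<in> Q j" "j \<in> {1..m}" "i \<le> m" "x \<in> X" "X \<subseteq> P"
  shows "card (X \<inter> initial i) = card ((X - {x}) \<inter> initial i) + of_bool (j \<le> i)"
  using card_insert_Int_initial[of x j i "X - {x}"] assms by (simp add: insert_absorb subset_iff)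

section \<open>Winning coalitions\<close>

lemma winning_subset: "X \<in> winning k \<Longrightarrow> X \<subseteq> P"
  by (simp add: conjunctive_hierarchical_def)

lemma winning_card: "X \<in> winning k \<Longrightarrow> i \<in> {1..m} \<Longrightarrow> k i \<le> card (X \<inter> initial i)"
  unfolding conjunctive_hierarchical_def by blast

lemma winningI:
  assumes "X \<subseteq> P" and "\<And>i. i \<in> {1..m} \<Longrightarrow> k i \<le> card (X \<inter> initial i)"
  shows "X \<in> winning k"
  using assms unfolding conjunctive_hierarchical_def by blast

lemma winning_superset:
  assumes "X \<in> winning k" "X \<subseteq> Y" "Y \<subseteq> P"
  shows "Y \<in> winning k"
proof (rule winningI[OF assms(3)])
  fix i assume i: "i \<in> {1..m}"
  have "card (X \<inter> initial i) \<le> card (Y \<inter> initial i)"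
    using assms finite_players by (intro card_mono) (auto intro: finite_subset)
  then show "k i \<le> card (Y \<inter> initial i)"
    using winning_card[OF assms(1) i] by simp
qed

text \<open>The right-hand side depends on the added player only through its block index
  \<open>j\<close>. Exchanging players therefore amounts to comparing the terms
  \<open>of_bool (j \<le> i)\<close>.\<close>

lemma insert_winning_iff:
  assumes "x \<in> Q j" "j \<in> {1..m}" "x \<notin> X" "X \<subseteq> P"
  shows "insert x X \<in> winning k \<longleftrightarrow>
    (\<forall>i\<in>{1..m}. k i \<le> card (X \<inter> initial i) + of_bool (j \<le> i))"
proof -
  have "insert x X \<subseteq> P" using assms block_subset by blast
  then have "insert x X \<in> winning k \<longleftrightarrow>
      (\<forall>i\<in>{1..m}. k i \<le> card (insert x X \<inter> initial i))"
    unfolding conjunctive_hierarchical_def by blast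
  also have "\<dots> \<longleftrightarrow> (\<forall>i\<in>{1..m}. k i \<le> card (X \<inter> initial i) + of_bool (j \<le> i))"
    using card_insert_Int_initial[OF assms(1,2) _ assms(3,4)] by simp
  finally show ?thesis .
qed

section \<open>Equivalent players\<close>

lemma same_block_equiv:
  assumes "x \<in> Q j" "y \<in> Q j" "j \<in> {1..m}"
  shows "(x, y) \<in> player_equiv P (winning k)"
  using assms insert_winning_iff block_subset[OF assms(3)] by (auto simp: player_equiv_def)

text \<open>Adding \<open>x\<close> or \<open>y\<close> makes a difference only to condition
  \<open>j - 1\<close>. As \<open>X\<close> omits \<open>y\<close>, it has fewer than
  \<open>card (Q j)\<close> players of block \<open>j\<close>, so condition \<open>j\<close> after
  the addition already forces condition \<open>j - 1\<close> for \<open>X\<close> itself.\<close>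

lemma adjacent_block_equiv:
  assumes j: "1 < j" "j \<le> m" and le: "k (j - 1) + card (Q j) \<le> k j"
    and x: "x \<in> Q (j - 1)" and y: "y \<in> Q j"
  shows "(x, y) \<in> player_equiv P (winning k)"
proof -
  have jm: "j - 1 \<in> {1..m}" "j \<in> {1..m}" using j by auto
  have P: "x \<in> P" "y \<in> P" using block_subset[OF jm(1)] block_subset[OF jm(2)] x y by auto
  have "insert x X \<in> winning k \<longleftrightarrow> insert y X \<in> winning k"
    if X: "X \<subseteq> P" "x \<notin> X" "y \<notin> X" for X
  proof -
    have iff: "j - 1 \<le> i \<longleftrightarrow> j \<le> i" if "i \<noteq> j - 1" for i using that j by auto
    have "card (X \<inter> initial j) = card (X \<inter> initial (j - 1)) + card (X \<inter> Q j)"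
      using j card_Int_initial[of j X] card_Int_initial[of "j - 1" X] by (cases j) auto
    moreover have "card (X \<inter> Q j) < card (Q j)"
      using X y finite_block[OF jm(2)] by (intro psubset_card_mono) auto
    ultimately have red: "k (j - 1) \<le> card (X \<inter> initial (j - 1))"
      if "k j \<le> card (X \<inter> initial j) + 1"
      using le that by linarith
    show ?thesis
      unfolding insert_winning_iff[OF x jm(1) X(2) X(1)] insert_winning_iff[OF y jm(2) X(3) X(1)]
    proof
      assume L: "\<forall>i\<in>{1..m}. k i \<le> card (X \<inter> initial i) + of_bool (j - 1 \<le> i)"
      show "\<forall>i\<in>{1..m}. k i \<le> card (X \<inter> initial i) + of_bool (j \<le> i)"
      proof
        fix i assume i: "i \<in> {1..m}"
        have "k j \<le> card (X \<inter> initial j) + 1" using L[rule_format, OF jm(2)] by simp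
        then show "k i \<le> card (X \<inter> initial i) + of_bool (j \<le> i)"
          using red L[rule_format, OF i] iff[of i] by (cases "i = j - 1") auto
      qed
    next
      assume "\<forall>i\<in>{1..m}. k i \<le> card (X \<inter> initial i) + of_bool (j \<le> i)"
      moreover have "of_bool (j \<le> i) \<le> (of_bool (j - 1 \<le> i) :: nat)" for i by auto
      ultimately show "\<forall>i\<in>{1..m}. k i \<le> card (X \<inter> initial i) + of_bool (j - 1 \<le> i)"
        by (meson add_left_mono order_trans)
    qed
  qed
  then show ?thesis using P by (simp add: player_equiv_def)
qed

section \<open>Critical coalitions\<close>

lemma obtain_coalition:
  assumes "\<And>i. i \<in> {1..m} \<Longrightarrow> c i \<le> card (Q i)"
  obtains X where "X \<subseteq> P" "\<And>i. i \<in> {1..m} \<Longrightarrow> card (X \<inter> Q i) = c i"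
proof -
  have "\<forall>i\<in>{1..m}. \<exists>S. S \<subseteq> Q i \<and> card S = c i"
    using assms by (meson obtain_subset_with_card_n)
  then obtain S where S: "\<And>i. i \<in> {1..m} \<Longrightarrow> S i \<subseteq> Q i \<and> card (S i) = c i"
    by metis
  let ?X = "\<Union>i\<in>{1..m}. S i"
  have "?X \<inter> Q i = S i" if "i \<in> {1..m}" for i
    using S that block_unique by blast
  moreover have "?X \<subseteq> P" using S block_subset by blast
  ultimately show thesis using that[of ?X] S by simp
qed

lemma obtain_critical_coalition:
  assumes k: "hierarchy_thresholds m k" and tight: "tight k" and i: "i \<in> {1..m}"
  obtains X where "X \<in> winning k" "card (X \<inter> initial i) = k i"
    "i < m \<Longrightarrow> X \<inter> Q i \<noteq> {}" "\<And>j. i < j \<Longrightarrow> j \<le> m \<Longrightarrow> \<not> Q j \<subseteq> X"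
proof -
  \<comment> \<open>Up to \<open>i\<close> the summands telescope to the thresholds; index 1 is
    separate because \<open>k 0\<close> is arbitrary. After \<open>i\<close>, all but one player of
    each block are taken, leaving one outside for an exchange.\<close>
  define c where "c l = (if l = 1 then k 1 else if l \<le> i then k l - k (l - 1) else card (Q l) - 1)"
    for l
  have step: "k l < k (l - 1) + card (Q l)" "k (l - 1) \<le> k l" if "1 < l" "l \<le> m" for l
    using tight k that hierarchy_thresholds_le[of m k "l - 1" l] by (auto simp: tight_def)
  have "c l \<le> card (Q l)" if "l \<in> {1..m}" for l
  proof (cases "l = 1 \<or> i < l")
    case True
    then show ?thesis using tight that by (auto simp: c_def tight_def)
  next
    case False
    then have "1 < l" "l \<le> m" using that by auto
    from step[OF this] show ?thesis using False by (simp add: c_def)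
  qed
  then obtain X where X: "X \<subseteq> P" "\<And>l. l \<in> {1..m} \<Longrightarrow> card (X \<inter> Q l) = c l"
    using obtain_coalition by blast
  have card_X: "card (X \<inter> initial t) = (\<Sum>l\<in>{1..t}. c l)" if "t \<le> m" for t
    using card_Int_initial[OF that, of X] X(2) that by simp
  \<comment> \<open>Equality holds as far as \<open>i\<close>. Beyond it each block contributes
    \<open>card (Q l) - 1\<close>, which by the strict inequality (b) is at least the increase of
    the threshold.\<close>
  have "(t \<le> i \<longrightarrow> (\<Sum>l\<in>{1..t}. c l) = k t) \<and> k t \<le> (\<Sum>l\<in>{1..t}. c l)"
    if "1 \<le> t" "t \<le> m" for t
    using that
  proof (induction t rule: nat_induct_at_least)
    case base
    then show ?case by (simp add: c_def)
  next
    case (Suc t)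
    have "k (Suc t) < k t + card (Q (Suc t))" "k t \<le> k (Suc t)"
      using step[of "Suc t"] Suc by auto
    then show ?case using Suc by (auto simp: c_def)
  qed
  then have 1: "X \<in> winning k" "card (X \<inter> initial i) = k i"
    using X(1) card_X i by (auto intro!: winningI)
  \<comment> \<open>For \<open>i = 1\<close> this is positivity of \<open>k 1\<close>, otherwise
    strictness of the chain before \<open>m\<close>. At \<open>i = m\<close> the increment may be
    zero, hence the restriction.\<close>
  have "0 < c i" if "i < m"
    using that i k hierarchy_thresholds_less[OF k, of "i - 1" i]
    by (auto simp: c_def hierarchy_thresholds_def)
  then have 2: "X \<inter> Q i \<noteq> {}" if "i < m"
    using X(2)[OF i] that by auto
  have 3: "\<not> Q j \<subseteq> X" if "i < j" "j \<le> m" for j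
  proof
    assume "Q j \<subseteq> X"
    then have "card (X \<inter> Q j) = card (Q j)" by (simp add: Int_absorb1)
    moreover have "card (X \<inter> Q j) = card (Q j) - 1" using X(2)[of j] that i by (auto simp: c_def)
    moreover have "0 < card (Q j)"
      using that i finite_block[of j] blocks_nonempty[of j] by (simp add: card_gt_0_iff)
    ultimately show False by linarith
  qed
  show thesis using that[OF 1 2 3] .
qed

section \<open>Equivalence classes and their number\<close>

lemma tight_equiv_same_block:
  assumes k: "hierarchy_thresholds m k" and tight: "tight k"
    and x: "x \<in> Q i" "i \<in> {1..m}" and y: "y \<in> Q j" "j \<in> {1..m}"
    and xy: "(x, y) \<in> player_equiv P (winning k)"
  shows "i = j"
proof -
  have no_less: False
    if x: "x \<in> Q i" "i \<in> {1..m}" and y: "y \<in> Q j" "j \<in> {1..m}"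
      and xy: "(x, y) \<in> player_equiv P (winning k)" and less: "i < j" for x y i j
  proof -
    obtain X where X: "X \<in> winning k" "card (X \<inter> initial i) = k i" "X \<inter> Q i \<noteq> {}"
        "\<not> Q j \<subseteq> X"
      using obtain_critical_coalition[OF k tight x(2)] y(2) less by (metis atLeastAtMost_iff less_le_trans)
    then obtain x' y' where x': "x' \<in> X" "x' \<in> Q i" and y': "y' \<in> Q j" "y' \<notin> X" by blast
    \<comment> \<open>Equivalence inside each block carries the assumption from \<open>x\<close> and
      \<open>y\<close> to the players that the critical coalition allows to be exchanged.\<close>
    have equiv: "(x', y') \<in> player_equiv P (winning k)"
      using same_block_equiv[OF x'(2) x(1) x(2)] same_block_equiv[OF y(1) y'(1) y(2)] xy
      by (meson player_equiv_trans)
    let ?Y = "X - {x'}"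
    have Y: "?Y \<subseteq> P" "x' \<notin> ?Y" "y' \<notin> ?Y" using winning_subset[OF X(1)] y' by auto
    have "insert x' ?Y \<in> winning k" using X(1) x' by (simp add: insert_absorb)
    then have "insert y' ?Y \<in> winning k" using equiv Y unfolding player_equiv_def by blast
    \<comment> \<open>The exchange loses one player among the first \<open>i\<close> blocks, where
      \<open>X\<close> had exactly \<open>k i\<close>, and \<open>y'\<close> lies beyond
      them.\<close>
    then have "k i \<le> card (insert y' ?Y \<inter> initial i)" using winning_card x(2) by blast
    also have "\<dots> = card (?Y \<inter> initial i)"
      using card_insert_Int_initial[OF y'(1) y(2) _ Y(3) Y(1), of i] x(2) less by simp
    finally show False
      using card_Diff_Int_initial[OF x'(2) x(2) _ x'(1) winning_subset[OF X(1)], of i] X(2) x(2)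
      by simp
  qed
  show ?thesis
    using no_less[OF x y xy] no_less[OF y x player_equiv_sym[OF xy]]
    by (cases rule: linorder_cases[of i j]) auto
qed

text \<open>Blocks may merge, so a class is described as the image of a block. This maps
  \<open>m\<close> indices onto the classes, and there are \<open>m\<close> classes exactly when the
  map is injective.\<close>

lemma quotient_eq: "P // player_equiv P (winning k) = (\<lambda>i. player_equiv P (winning k) `` Q i) ` {1..m}"
  (is "P // ?E = _")
proof -
  have cls: "?E `` {x} = ?E `` Q i" if "x \<in> Q i" "i \<in> {1..m}" for x i
  proof
    show "?E `` {x} \<subseteq> ?E `` Q i" using that(1) by auto
    show "?E `` Q i \<subseteq> ?E `` {x}"
    proof
      fix z assume "z \<in> ?E `` Q i"
      then obtain y where "y \<in> Q i" "(y, z) \<in> ?E" by auto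
      then have "(x, z) \<in> ?E"
        using player_equiv_trans[OF same_block_equiv[OF that(1) _ that(2)]] by auto
      then show "z \<in> ?E `` {x}" by auto
    qed
  qed
  show ?thesis
  proof (intro equalityI subsetI)
    fix A assume "A \<in> P // ?E"
    then obtain x where "x \<in> P" "A = ?E `` {x}" by (rule quotientE)
    moreover obtain i where "i \<in> {1..m}" "x \<in> Q i"
      using \<open>x \<in> P\<close> union_blocks by blast
    ultimately show "A \<in> (\<lambda>i. ?E `` Q i) ` {1..m}" using cls by blast
  next
    fix A assume "A \<in> (\<lambda>i. ?E `` Q i) ` {1..m}"
    then obtain i where i: "i \<in> {1..m}" "A = ?E `` Q i" by blast
    then obtain x where x: "x \<in> Q i" using blocks_nonempty by blast
    have "A = ?E `` {x}" using i(2) cls[OF x i(1)] by simp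
    then show "A \<in> P // ?E" using quotientI x block_subset[OF i(1)] by (metis subsetD)
  qed
qed

lemma tight_quotient_eq:
  assumes "hierarchy_thresholds m k" "tight k"
  shows "P // player_equiv P (winning k) = Q ` {1..m}"
proof -
  have "player_equiv P (winning k) `` Q i = Q i" if i: "i \<in> {1..m}" for i
  proof (intro equalityI subsetI)
    fix y assume "y \<in> player_equiv P (winning k) `` Q i"
    then obtain x where x: "x \<in> Q i" "(x, y) \<in> player_equiv P (winning k)" by auto
    then have "y \<in> P" by (simp add: player_equiv_def)
    then obtain j where "y \<in> Q j" "j \<in> {1..m}" using union_blocks by auto
    then show "y \<in> Q i" using tight_equiv_same_block[OF assms x(1) i _ _ x(2)] by blast
  next
    fix x assume "x \<in> Q i"
    then show "x \<in> player_equiv P (winning k) `` Q i" using same_block_equiv i by blast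
  qed
  then show ?thesis unfolding quotient_eq by (intro image_cong) auto
qed

lemma card_quotient_iff_tight:
  assumes k: "hierarchy_thresholds m k" and "1 \<le> m" and ne: "winning k \<noteq> {}"
  shows "card (P // player_equiv P (winning k)) = m \<longleftrightarrow> tight k"
proof
  assume "tight k"
  then show "card (P // player_equiv P (winning k)) = m"
    using tight_quotient_eq[OF k] card_image[OF inj_on_blocks] by simp
next
  let ?E = "player_equiv P (winning k)"
  assume card: "card (P // ?E) = m"
  have inj: "inj_on (\<lambda>i. ?E `` Q i) {1..m}"
    using card unfolding quotient_eq by (intro eq_card_imp_inj_on) auto
  \<comment> \<open>Condition (a) comes from the existence of a winning coalition, not from the
    number of classes.\<close>
  obtain X where "X \<in> winning k" using ne by blast
  then have "k 1 \<le> card (X \<inter> Q 1)" using winning_card[of X k 1] \<open>1 \<le> m\<close> by simp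
  also have "\<dots> \<le> card (Q 1)" using finite_block[of 1] \<open>1 \<le> m\<close> by (intro card_mono) auto
  finally have "k 1 \<le> card (Q 1)" .
  moreover have "k i < k (i - 1) + card (Q i)" if i: "1 < i" "i \<le> m" for i
  proof (rule ccontr)
    assume "\<not> ?thesis"
    then have le: "k (i - 1) + card (Q i) \<le> k i" by simp
    have im: "i - 1 \<in> {1..m}" "i \<in> {1..m}" using i by auto
    \<comment> \<open>A failure of (b) merges two neighbouring blocks, contradicting
      injectivity.\<close>
    have "?E `` Q (i - 1) = ?E `` Q i"
    proof -
      have ne: "Q (i - 1) \<noteq> {}" "Q i \<noteq> {}" by (rule blocks_nonempty, rule im)+
      note E = adjacent_block_equiv[OF i le]
      show ?thesis
      proof (intro equalityI subsetI)
        fix z assume "z \<in> ?E `` Q (i - 1)"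
        then obtain x where x: "x \<in> Q (i - 1)" "(x, z) \<in> ?E" by auto
        obtain y where y: "y \<in> Q i" using ne by auto
        have "(y, z) \<in> ?E" by (rule player_equiv_trans[OF player_equiv_sym[OF E[OF x(1) y]] x(2)])
        then show "z \<in> ?E `` Q i" using y by auto
      next
        fix z assume "z \<in> ?E `` Q i"
        then obtain y where y: "y \<in> Q i" "(y, z) \<in> ?E" by auto
        obtain x where x: "x \<in> Q (i - 1)" using ne by auto
        have "(x, z) \<in> ?E" by (rule player_equiv_trans[OF E[OF x y(1)] y(2)])
        then show "z \<in> ?E `` Q (i - 1)" using x by auto
      qed
    qed
    then have "i - 1 = i" using inj_onD[OF inj] im by blast
    then show False using i by simp
  qed
  ultimately show "tight k" by (simp add: tight_def)
qed

lemma tight_canonical_representation: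
  assumes "hierarchy_thresholds m k" "tight k"
  shows "\<exists>V. canonical_representation P (winning k)
    (\<Sum>i\<in>{1..m}. replicate_mset (card (Q i)) i) V"
proof -
  have "bij_betw Q {1..m} (P // player_equiv P (winning k))"
    using tight_quotient_eq[OF assms] inj_on_blocks by (simp add: bij_betw_def)
  then show ?thesis unfolding canonical_representation_def by blast
qed

section \<open>Comparison of thresholds\<close>

text \<open>A coalition that is critical for \<open>k\<close> at \<open>i\<close> has exactly
  \<open>k i\<close> players in the first \<open>i\<close> blocks, yet must meet the threshold
  \<open>k' i\<close>. Inclusions both ways give equal thresholds.\<close>

lemma tight_threshold_le:
  assumes "hierarchy_thresholds m k" "tight k" "winning k \<subseteq> winning k'" "i \<in> {1..m}"
  shows "k' i \<le> k i"
proof -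
  obtain X where "X \<in> winning k" "card (X \<inter> initial i) = k i"
    using obtain_critical_coalition assms by metis
  then show ?thesis using winning_card[of X k' i] assms by auto
qed

section \<open>Dummies in the last block\<close>

text \<open>Deleting \<open>p\<close> affects only condition \<open>m\<close>, which follows from
  condition \<open>m - 1\<close> when the two thresholds agree. Hence no winning coalition needs
  \<open>p\<close>.\<close>

lemma last_block_dummy:
  assumes m: "2 \<le> m" and eq: "k (m - 1) = k m" and p: "p \<in> Q m"
  shows "dummy P (winning k) p"
proof -
  have mm: "m \<in> {1..m}" "m - 1 \<in> {1..m}" using m by auto
  have "X - {p} \<in> winning k" if X: "X \<in> winning k" "p \<in> X" for X
  proof (rule winningI)
    show "X - {p} \<subseteq> P" using winning_subset[OF X(1)] by auto
    fix i assume i: "i \<in> {1..m}"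
    have less: "k l \<le> card ((X - {p}) \<inter> initial l)" if "l \<in> {1..m}" "l < m" for l
      using card_Diff_Int_initial[OF p mm(1) _ X(2) winning_subset[OF X(1)], of l]
        winning_card[OF X(1) that(1)] that(2) by simp
    show "k i \<le> card ((X - {p}) \<inter> initial i)"
    proof (cases "i = m")
      case False
      then show ?thesis using less i by auto
    next
      case True
      have "k m \<le> card ((X - {p}) \<inter> initial (m - 1))" using less[of "m - 1"] mm eq m by simp
      also have "\<dots> \<le> card ((X - {p}) \<inter> initial m)"
        using finite_players winning_subset[OF X(1)]
        by (intro card_mono) (auto intro: finite_subset)
      finally show ?thesis using True by simp
    qed
  qed
  then have "\<not> (\<exists>X. minimal_winning (winning k) X \<and> p \<in> X)"
    unfolding minimal_winning_def by blast
  then show ?thesis using p block_subset[OF mm(1)] by (auto simp: dummy_def)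
qed

text \<open>A smallest winning coalition \<open>X\<close> containing \<open>p\<close> is minimal winning: otherwise \<open>X - {p}\<close> is
  winning too, so \<open>X\<close> has more than \<open>k\<^sub>m\<close> players, and deleting a player \<open>z \<noteq> p\<close> from the last
  possible block keeps \<open>X\<close> winning.\<close>

lemma last_block_not_dummy:
  assumes k: "hierarchy_thresholds m k" and m: "2 \<le> m" and less: "k (m - 1) < k m"
    and p: "p \<in> Q m" and ne: "winning k \<noteq> {}"
  shows "\<not> dummy P (winning k) p"
proof -
  have mm: "m \<in> {1..m}" using m by auto
  have pP: "p \<in> P" using p block_subset[OF mm] by auto
  obtain X0 where "X0 \<in> winning k" using ne by blast
  then have "P \<in> winning k" using winning_superset winning_subset by blast
  then obtain X where X: "X \<in> winning k" "p \<in> X"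
    and min: "\<And>Y. Y \<in> winning k \<Longrightarrow> p \<in> Y \<Longrightarrow> card X \<le> card Y"
    using pP ex_has_least_nat[of "\<lambda>X. X \<in> winning k \<and> p \<in> X" P card] by metis
  have XP: "X \<subseteq> P" using winning_subset[OF X(1)] .
  then have finX: "finite X" using finite_players finite_subset by blast
  have del: "X - {z} \<notin> winning k" if "z \<in> X" "z \<noteq> p" for z
  proof
    assume "X - {z} \<in> winning k"
    then have "card X \<le> card (X - {z})" using min that X(2) by blast
    then show False using card_Diff1_less[OF finX that(1)] by simp
  qed
  have "minimal_winning (winning k) X"
  proof (rule ccontr)
    assume "\<not> ?thesis"
    then obtain Y where Y: "Y \<subset> X" "Y \<in> winning k"
      unfolding minimal_winning_def using X by blast
    then obtain z where z: "z \<in> X" "z \<notin> Y" by blast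
    have "X - {z} \<in> winning k"
    proof (rule winning_superset[OF Y(2)])
      show "Y \<subseteq> X - {z}" "X - {z} \<subseteq> P" using Y(1) z(2) XP by auto
    qed
    \<comment> \<open>Minimality was imposed only among coalitions containing \<open>p\<close>, so
      it excludes every deletion except that of \<open>p\<close> itself.\<close>
    then have Xp: "X - {p} \<in> winning k" using del[OF z(1)] by (cases "z = p") auto
    have "X - {p} \<subseteq> P" using XP by auto
    then have card: "k m < card X"
      using winning_card[OF Xp mm] card_Diff1_less[OF finX X(2)] initial_eq
      by (simp add: Int_absorb2)
    have pos: "0 < k m" using less by simp
    \<comment> \<open>The indices of the blocks met by \<open>X - {p}\<close>. Their maximum is the
      block from which \<open>w\<close> is deleted.\<close>
    let ?B = "{l \<in> {1..m}. (X - {p}) \<inter> Q l \<noteq> {}}"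
    have "X - {p} \<noteq> {}"
    proof
      assume "X - {p} = {}"
      then have "X = {p}" using X(2) by auto
      then show False using card pos by simp
    qed
    then obtain v where v: "v \<in> X - {p}" by blast
    then obtain j where "j \<in> {1..m}" "v \<in> Q j" using XP union_blocks by blast
    then have "j \<in> ?B" using v by blast
    then have "?B \<noteq> {}" by blast
    then have MaxB: "Max ?B \<in> ?B" by (intro Max_in) auto
    define l where "l = Max ?B"
    have l: "l \<in> {1..m}" using MaxB by (simp add: l_def)
    obtain w where w: "w \<in> X" "w \<noteq> p" "w \<in> Q l" using MaxB unfolding l_def by blast
    have last: "X - {p} \<subseteq> initial l"
    proof
      fix v assume v: "v \<in> X - {p}"
      then obtain j where j: "j \<in> {1..m}" "v \<in> Q j" using XP union_blocks by blast
      then have "j \<in> ?B" using v by blast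
      then have "j \<le> l" unfolding l_def by (intro Max_ge) auto
      then show "v \<in> initial l" using j by auto
    qed
    have "X - {w} \<in> winning k"
    proof (rule winningI)
      show "X - {w} \<subseteq> P" using XP by auto
      fix i assume i: "i \<in> {1..m}"
      have eq: "card (X \<inter> initial i) = card ((X - {w}) \<inter> initial i) + of_bool (l \<le> i)"
        using card_Diff_Int_initial[OF w(3) l _ w(1) XP, of i] i by simp
      \<comment> \<open>Conditions before \<open>l\<close> do not count \<open>w\<close>. From
        \<open>l\<close> to \<open>m - 1\<close> all of \<open>X - {p}\<close> is counted, so at
        least \<open>card X - 2 \<ge> k m - 1 \<ge> k (m - 1)\<close> players remain; this uses the
        strict last inequality. At \<open>m\<close> there remain
        \<open>card X - 1 \<ge> k m\<close>.\<close>
      consider "i < l" | "l \<le> i" "i < m" | "i = m" using i by fastforce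
      then show "k i \<le> card ((X - {w}) \<inter> initial i)"
      proof cases
        case 1
        then show ?thesis using eq winning_card[OF X(1) i] by simp
      next
        case 2
        have "card (X - {p}) \<le> card (X \<inter> initial i)"
        proof (rule card_mono)
          show "finite (X \<inter> initial i)" using finX by simp
          have "initial l \<subseteq> initial i" using 2 by (intro UN_mono) auto
          with last have "X - {p} \<subseteq> initial i" by (rule subset_trans)
          then show "X - {p} \<subseteq> X \<inter> initial i" by blast
        qed
        moreover have "card (X - {p}) = card X - 1" using X(2) by simp
        moreover have "k i \<le> k (m - 1)"
          using hierarchy_thresholds_le[OF k, of i "m - 1"] i 2 by auto
        ultimately show ?thesis using eq 2 card less by simp
      next
        case 3
        then show ?thesis using eq card l XP initial_eq by (simp add: Int_absorb2)
      qed
    qed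
    then show False using del[OF w(1,2)] by simp
  qed
  then show ?thesis using X(2) by (auto simp: dummy_def)
qed

end

theorem theorem5:
  fixes P :: "'a set" and m :: nat and Q :: "nat \<Rightarrow> 'a set" and n k :: "nat \<Rightarrow> nat"
    and H :: "'a set set"
  assumes "finite P"
    and "1 \<le> m"
    and "P = (\<Union>i\<in>{1..m}. Q i)"
    and "disjoint_family_on Q {1..m}"
    and "\<And>i. i \<in> {1..m} \<Longrightarrow> Q i \<noteq> {}"
    and "\<And>i. i \<in> {1..m} \<Longrightarrow> n i = card (Q i)"
    and "hierarchy_thresholds m k"
    and "H = conjunctive_hierarchical P m Q k"
    and "simple_game P H"
  shows "(card (P // player_equiv P H) = m \<longleftrightarrow>
           k 1 \<le> n 1 \<and> (\<forall>i. 1 < i \<and> i \<le> m \<longrightarrow> k i < k (i - 1) + n i)) \<and>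
         (card (P // player_equiv P H) = m \<longrightarrow>
           (\<exists>V. canonical_representation P H (\<Sum>i\<in>{1..m}. replicate_mset (n i) i) V)) \<and>
         (k 1 \<le> n 1 \<and> (\<forall>i. 1 < i \<and> i \<le> m \<longrightarrow> k i < k (i - 1) + n i) \<longrightarrow>
           (\<forall>k'. hierarchy_thresholds m k' \<and> conjunctive_hierarchical P m Q k' = H \<longrightarrow>
             (\<forall>i\<in>{1..m}. k' i = k i))) \<and>
         (2 \<le> m \<longrightarrow> ((\<forall>p\<in>Q m. dummy P H p) \<longleftrightarrow> k (m - 1) = k m))"
proof -
  interpret player_partition P m Q
    using assms(1,3,4,5) by unfold_locales auto
  note k = assms(7) and H = assms(8) and n = assms(6)
  have ne: "winning k \<noteq> {}" using assms(9) H by (simp add: simple_game_def)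
  have tight_iff: "tight k \<longleftrightarrow>
      k 1 \<le> n 1 \<and> (\<forall>i. 1 < i \<and> i \<le> m \<longrightarrow> k i < k (i - 1) + n i)"
    using n \<open>1 \<le> m\<close> by (auto simp: tight_def)
  have card_iff: "card (P // player_equiv P H) = m \<longleftrightarrow> tight k"
    using card_quotient_iff_tight[OF k \<open>1 \<le> m\<close> ne] H by simp
  have "\<exists>V. canonical_representation P H (\<Sum>i\<in>{1..m}. replicate_mset (n i) i) V" if "tight k"
    using tight_canonical_representation[OF k that] H n by simp
  moreover have "k' i = k i"
    if "tight k" and k': "hierarchy_thresholds m k'" "winning k' = H" and i: "i \<in> {1..m}" for k' i
  proof -
    \<comment> \<open>Tightness of \<open>k'\<close> is not assumed: it is read off from the number
      of classes, which depends only on the game. The two sequences then play symmetric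
      roles.\<close>
    have "tight k'"
      using card_quotient_iff_tight[OF k'(1) \<open>1 \<le> m\<close>] k'(2) ne H card_iff \<open>tight k\<close> by simp
    then show ?thesis
      using tight_threshold_le[OF k'(1) _ _ i, of k] tight_threshold_le[OF k \<open>tight k\<close> _ i, of k']
        k'(2) H by simp
  qed
  moreover have "(\<forall>p\<in>Q m. dummy P H p) \<longleftrightarrow> k (m - 1) = k m" if m: "2 \<le> m"
  proof
    assume all: "\<forall>p\<in>Q m. dummy P H p"
    obtain p where "p \<in> Q m" using blocks_nonempty[of m] m by auto
    then have "\<not> k (m - 1) < k m" using last_block_not_dummy[OF k m _ _ ne] all H by blast
    then show "k (m - 1) = k m" using k m by (simp add: hierarchy_thresholds_def)
  next
    assume "k (m - 1) = k m"
    then show "\<forall>p\<in>Q m. dummy P H p" using last_block_dummy[OF m] H by blast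
  qed
  ultimately show ?thesis
    unfolding card_iff tight_iff[symmetric] by blast
qed

end
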